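(* Suppose that assumptions $(A1)$, $(A2)$, $(A3)$, $(A4)$ and $(A5)$ (stated in the context) hold true. Then the iterations of the local-minimum greedy algorithm described in the context are well-defined, in the sense that, at each iteration $n\in\mathbb{N}^*$, the minimization problem for $V_t\times V_x\ni(r,s)\mapsto\mathcal{E}(u_{n-1}+r\otimes s)$ has at least one local minimizer $(r_n,s_n)$ which satisfies $\mathcal{E}(u_n)<\mathcal{E}(u_{n-1})$, where $u_n=u_{n-1}+r_n\otimes s_n$. Moreover, the sequence $(u_n)_{n\in\mathbb{N}^*}$ strongly converges in $V$ towards $u$, the unique global minimizer of $\mathcal{E}$ on $V$.
   Context: Let $p,d$ be positive integers and $\mathcal{T}\subset\mathbb{R}^p$, $\mathcal{X}\subset\mathbb{R}^d$ open sets. $V_t$ and $V_x$ are Hilbert spaces of real-valued functions defined on $\mathcal{T}$ and $\mathcal{X}$ respectively (typically $L^2$ or Sobolev spaces), with norms $\|\cdot\|_{V_t}$ and $\|\cdot\|_{V_x}$. For $(r,s)\in V_t\times V_x$, $r\otimes s$ is the function $(t,x)\mapsto r(t)s(x)$ on $\mathcal{T}\times\mathcal{X}$, and $\Sigma=\{r\otimes s \mid (r,s)\in V_t\times V_x\}$. $V$ is a Hilbert space of real-valued functions defined on $\mathcal{T}\times\mathcal{X}$, with scalar product $\langle\cdot,\cdot\rangle$ and associated norm $\|\cdot\|_V$. $\mathcal{E}:V\to\mathbb{R}$ is a differentiable functional, and $\mathcal{E}'(v)\in V$ denotes its gradient at $v\in V$. $\mathbb{N}^*=\{1,2,\dots\}$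 and $\mathbb{R}_+=[0,+\infty)$. Assumptions: - $(A1)$ $\mathrm{Span}(\Sigma)$ is a dense subset of $V$ for $\|\cdot\|_V$. - $(A2)$ For all sequences of $\Sigma$ bounded in $V$, there exists a subsequence which weakly converges in $V$ towards an element of $\Sigma$. - $(A3)$ $\mathcal{E}$ is strongly convex for $\|\cdot\|_V$: there is a constant $\alpha>0$ such that for all $v,w\in V$, $\mathcal{E}(v)\ge \mathcal{E}(w)+\langle \mathcal{E}'(w),v-w\rangle+\frac{\alpha}{2}\|v-w\|_V^2$. - $(A4)$ The gradient of $\mathcal{E}$ is Lipschitz on bounded sets: for each bounded subset $K$ of $V$ there is a constant $L_K\in\mathbb{R}_+$ such that $\|\mathcal{E}'(v)-\mathcal{E}'(w)\|_V\le L_K\|v-w\|_V$ for all $v,w\in K$. - $(A5)$ There exist $\beta,\gamma\in\mathbb{R}_+$ with $\beta>0$ such that for all $(r,s)\in V_t\times V_x$, $\beta\|r\|_{V_t}\|s\|_{V_x}\le\|r\otimes s\|_V\le\gamma\|r\|_{V_t}\|s\|_{V_x}$. The unique global minimizer of $\mathcal{E}$ on $V$, whose existence and uniqueness are ensured by the strong convexity of $\mathcal{E}$, is denoted by $u$. Local-minimum greedy algorithm: set $u_n=\sum_{k=1}^n r_k\otimes s_k$ (so $u_0=0$), where $(r_n,s_n)\in V_t\times V_x$ is defined recursively, for $n\in\mathbb{N}^*$, as a local minimizer over $V_t\times V_x$ of $(r,s)\mapsto\mathcal{E}(u_{n-1}+r\otimes s)$ such that $\mathcal{E}(u_n)<\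mathcal{E}(u_{n-1})$.
   Formalization: Existence of a local minimizer with E(u_n) < E(u_{n-1}) is claimed only when u_{n-1} is not already the global minimizer u (strict decrease from u is impossible, e.g. E(v)=‖v‖²/2, u_0=0=u); after reaching u the algorithm keeps the iterate, and convergence covers such runs too. *)

theory Defs
  imports "HOL-Analysis.Analysis"
begin

text \<open>
  A Hilbert space of real-valued functions on a set \<open>S\<close> is rendered as a Hilbert space type \<open>'h\<close>
  together with a map \<open>\<phi>\<close> sending each element to the function it stands for. Two functions are
  identified either when they are equal everywhere on \<open>S\<close> (spaces of functions in the literal
  sense) or when they are equal Lebesgue-almost everywhere on \<open>S\<close> (as in Lebesgue and Sobolev spaces).
\<close>

datatype identification = Everywhere | Almost_everywhere

definition agree_on ::
  "identification \<Rightarrow> 'a::euclidean_space set \<Rightarrow> ('a \<Rightarrow> real) \<Rightarrow> ('a \<Rightarrow> real) \<Rightarrow> bool" where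
  "agree_on m S f g \<longleftrightarrow>
    (case m of
       Everywhere \<Rightarrow> (\<forall>z\<in>S. f z = g z)
     | Almost_everywhere \<Rightarrow> (AE z in lborel. z \<in> S \<longrightarrow> f z = g z))"

definition function_space_on ::
  "identification \<Rightarrow> 'a::euclidean_space set \<Rightarrow> ('h::real_vector \<Rightarrow> 'a \<Rightarrow> real) \<Rightarrow> bool" where
  "function_space_on m S \<phi> \<longleftrightarrow>
    (\<forall>f g. agree_on m S (\<phi> (f + g)) (\<lambda>z. \<phi> f z + \<phi> g z)) \<and>
    (\<forall>c f. agree_on m S (\<phi> (c *\<^sub>R f)) (\<lambda>z. c * \<phi> f z)) \<and>
    (\<forall>f g. agree_on m S (\<phi> f) (\<phi> g) \<longrightarrow> f = g)"

definition weakly_converges_to :: "(nat \<Rightarrow> 'h::real_normed_vector) \<Rightarrow> 'h \<Rightarrow> bool" where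
  "weakly_converges_to v l \<longleftrightarrow>
    (\<forall>f::'h \<Rightarrow> real. bounded_linear f \<longrightarrow> (\<lambda>n. f (v n)) \<longlonglongrightarrow> f l)"

definition global_minimizer :: "('a \<Rightarrow> real) \<Rightarrow> 'a \<Rightarrow> bool" where
  "global_minimizer f x \<longleftrightarrow> (\<forall>y. f x \<le> f y)"

definition local_minimizer :: "('a::topological_space \<Rightarrow> real) \<Rightarrow> 'a \<Rightarrow> bool" where
  "local_minimizer f x \<longleftrightarrow> (\<forall>\<^sub>F y in nhds x. f x \<le> f y)"

text \<open>
  In the following, \<open>tens r s\<close> is the element \<open>r \<otimes> s\<close>. Sequences of factors are indexed from 1;
  their value at 0 is irrelevant.
\<close>

definition simple_tensors :: "('t \<Rightarrow> 'x \<Rightarrow> 'v) \<Rightarrow> 'v set" where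
  "simple_tensors tens = {tens r s | r s. True}"

definition greedy_sum ::
  "('t \<Rightarrow> 'x \<Rightarrow> 'v::real_vector) \<Rightarrow> (nat \<Rightarrow> 't) \<Rightarrow> (nat \<Rightarrow> 'x) \<Rightarrow> nat \<Rightarrow> 'v" where
  "greedy_sum tens r s n = (\<Sum>k=1..n. tens (r k) (s k))"

definition greedy_step ::
  "('v::real_vector \<Rightarrow> real) \<Rightarrow> ('t::topological_space \<Rightarrow> 'x::topological_space \<Rightarrow> 'v)
    \<Rightarrow> 'v \<Rightarrow> 't \<Rightarrow> 'x \<Rightarrow> bool" where
  "greedy_step \<E> tens w r s \<longleftrightarrow>
    local_minimizer (\<lambda>(r', s'). \<E> (w + tens r' s')) (r, s) \<and> \<E> (w + tens r s) < \<E> w"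

text \<open>
  No strict decrease is possible from a global minimizer: the algorithm stops there, that is,
  the iterate is kept from then on.
\<close>

definition greedy_iteration ::
  "('v::real_vector \<Rightarrow> real) \<Rightarrow> ('t::topological_space \<Rightarrow> 'x::topological_space \<Rightarrow> 'v)
    \<Rightarrow> (nat \<Rightarrow> 't) \<Rightarrow> (nat \<Rightarrow> 'x) \<Rightarrow> nat \<Rightarrow> bool" where
  "greedy_iteration \<E> tens r s n \<longleftrightarrow>
    greedy_step \<E> tens (greedy_sum tens r s (n - 1)) (r n) (s n) \<or>
    global_minimizer \<E> (greedy_sum tens r s (n - 1)) \<and> tens (r n) (s n) = 0"

end

theory Submission
  imports Defs
begin

text \<open>
  The map \<open>(r, s) \<mapsto> r \<otimes> s\<close> is bilinear because pointwise products of functions are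
  (\<open>bounded_bilinear_tensor\<close>), so the set of simple tensors is stable under scaling. A gradient that
  is orthogonal to all simple tensors vanishes by density; hence, away from the minimizer, moving a
  little along some tensor decreases the energy. A minimizing sequence of tensors is bounded by
  strong convexity, and a weak limit of it inside the simple tensors attains the infimum, as convex
  functionals are weakly lower semicontinuous. Each iteration therefore even has a global best
  tensor (\<open>ex_greedy_step\<close>).

  Write \<open>z\<^sub>n = r\<^sub>n \<otimes> s\<^sub>n\<close>. Stationarity in \<open>r\<^sub>n\<close> makes \<open>z\<^sub>n\<close> orthogonal to \<open>\<E>' u\<^sub>n\<close>, so strong
  convexity turns the decrease of the energy into a bound on \<open>\<Sum> \<parallel>z\<^sub>n\<parallel>\<^sup>2\<close>. What local minimality
  has to supply in addition is that the new gradient is small on \<^emph>\<open>all\<close> simple tensors \<open>y\<close>: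
  \<open>\<bar>\<langle>\<E>' u\<^sub>n, y\<rangle>\<bar> \<le> C \<parallel>z\<^sub>n\<parallel> \<parallel>y\<parallel>\<close> (\<open>greedy_step_gradient_bound\<close>). This is a second-order condition:
  perturbing both factors at once by \<open>c a\<close> and \<open>c b\<close>, the terms of order \<open>c\<close> vanish by
  stationarity, and the mixed term \<open>c\<^sup>2 \<langle>\<E>' u\<^sub>n, a \<otimes> b\<rangle>\<close> can only be compensated by the quadratic
  remainder, which is of the size \<open>c\<^sup>2 \<parallel>z\<^sub>n\<parallel>\<^sup>2\<close> if \<open>a\<close> and \<open>b\<close> have the norms of \<open>r\<^sub>n\<close> and \<open>s\<^sub>n\<close>.

  These estimates imply convergence (\<open>greedy_sums_converge\<close>). By convexity
  \<open>\<E> u\<^sub>n - \<E> u \<le> \<langle>\<E>' u\<^sub>n, u\<^sub>n\<rangle> - \<langle>\<E>' u\<^sub>n, u\<rangle>\<close>. The second term tends to 0 because the bounded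
  gradients tend to 0 on the simple tensors, whose span is dense. The first is at most
  \<open>C \<parallel>z\<^sub>n\<parallel> \<Sum>k\<le>n. \<parallel>z\<^sub>k\<parallel>\<close>, hence at most a multiple of \<open>sqrt (n \<parallel>z\<^sub>n\<parallel>\<^sup>2)\<close>, and \<open>n \<parallel>z\<^sub>n\<parallel>\<^sup>2\<close> gets
  arbitrarily small along a subsequence since the harmonic series diverges. As the energies
  decrease, a subsequence is enough.
\<close>

section \<open>Bilinearity of the tensor product\<close>

lemma agree_on_refl: "agree_on m S f f"
  by (cases m) (auto simp: agree_on_def)

lemma agree_on_sym: "agree_on m S f g \<Longrightarrow> agree_on m S g f"
  by (cases m) (auto simp: agree_on_def)

lemma agree_on_trans [trans]:
  assumes "agree_on m S f g" "agree_on m S g h"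
  shows "agree_on m S f h"
proof (cases m)
  case Everywhere
  then show ?thesis using assms by (auto simp: agree_on_def)
next
  case Almost_everywhere
  have "AE z in lborel. z \<in> S \<longrightarrow> f z = g z" "AE z in lborel. z \<in> S \<longrightarrow> g z = h z"
    using assms Almost_everywhere by (auto simp: agree_on_def)
  then have "AE z in lborel. z \<in> S \<longrightarrow> f z = h z"
    by eventually_elim auto
  then show ?thesis using Almost_everywhere by (simp add: agree_on_def)
qed

text \<open>With a function \<open>F\<close> of two arguments, sums and multiples are both instances.\<close>

lemma agree_on_combine:
  assumes "agree_on m S f f'" "agree_on m S g g'"
  shows "agree_on m S (\<lambda>z. F (f z) (g z)) (\<lambda>z. F (f' z) (g' z))"
proof (cases m)
  case Everywhere
  then show ?thesis using assms by (auto simp: agree_on_def)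
next
  case Almost_everywhere
  have "AE z in lborel. z \<in> S \<longrightarrow> f z = f' z" "AE z in lborel. z \<in> S \<longrightarrow> g z = g' z"
    using assms Almost_everywhere by (auto simp: agree_on_def)
  then have "AE z in lborel. z \<in> S \<longrightarrow> F (f z) (g z) = F (f' z) (g' z)"
    by eventually_elim auto
  then show ?thesis using Almost_everywhere by (simp add: agree_on_def)
qed

text \<open>A cylinder over a null set is a null set, since the Lebesgue measure on a product space is the
  product measure.\<close>

lemma AE_lborel_fst:
  assumes "AE t in (lborel :: 'a::euclidean_space measure). P t"
  shows "AE z in (lborel :: ('a \<times> 'b::euclidean_space) measure). P (fst z)"
proof -
  obtain N where N: "N \<in> null_sets (lborel :: 'a measure)" "{t. \<not> P t} \<subseteq> N"
    using assms by (auto simp: eventually_ae_filter)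
  have "N \<times> (UNIV :: 'b set) \<in> null_sets (lborel \<Otimes>\<^sub>M lborel)"
    using N(1) by (intro lborel.times_in_null_sets1) auto
  then have "N \<times> (UNIV :: 'b set) \<in> null_sets lborel"
    by (simp only: lborel_prod)
  then show ?thesis
    using N(2) by (intro AE_I') auto
qed

lemma AE_lborel_snd:
  assumes "AE x in (lborel :: 'b::euclidean_space measure). P x"
  shows "AE z in (lborel :: ('a::euclidean_space \<times> 'b) measure). P (snd z)"
proof -
  obtain N where N: "N \<in> null_sets (lborel :: 'b measure)" "{t. \<not> P t} \<subseteq> N"
    using assms by (auto simp: eventually_ae_filter)
  have "(UNIV :: 'a set) \<times> N \<in> null_sets (lborel \<Otimes>\<^sub>M lborel)"
    using N(1) by (intro lborel.times_in_null_sets2) auto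
  then have "(UNIV :: 'a set) \<times> N \<in> null_sets lborel"
    by (simp only: lborel_prod)
  then show ?thesis
    using N(2) by (intro AE_I') auto
qed

lemma agree_on_tensor:
  assumes "agree_on m S f f'" "agree_on m T g g'"
  shows "agree_on m (S \<times> T) (\<lambda>(t, x). f t * g x) (\<lambda>(t, x). f' t * g' x)"
proof (cases m)
  case Everywhere
  then show ?thesis using assms by (auto simp: agree_on_def)
next
  case Almost_everywhere
  have f: "AE t in lborel. t \<in> S \<longrightarrow> f t = f' t" and g: "AE x in lborel. x \<in> T \<longrightarrow> g x = g' x"
    using assms Almost_everywhere by (auto simp: agree_on_def)
  have "AE z in lborel. z \<in> S \<times> T \<longrightarrow>
      (case z of (t, x) \<Rightarrow> f t * g x) = (case z of (t, x) \<Rightarrow> f' t * g' x)"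
    using AE_lborel_fst[OF f] AE_lborel_snd[OF g] by eventually_elim auto
  then show ?thesis using Almost_everywhere by (simp add: agree_on_def)
qed

text \<open>The map \<open>tens\<close> is only given through the functions that its values represent. Bilinearity of the
  pointwise product lifts to it because functions identified by \<open>m\<close> come from the same element.\<close>

lemma bounded_bilinear_tensor:
  fixes tens :: "'vt::real_normed_vector \<Rightarrow> 'vx::real_normed_vector \<Rightarrow> 'v::real_normed_vector"
  assumes Vt: "function_space_on m S \<phi>\<^sub>t"
    and Vx: "function_space_on m T \<phi>\<^sub>x"
    and V: "function_space_on m (S \<times> T) \<phi>"
    and tens: "\<And>r s. agree_on m (S \<times> T) (\<phi> (tens r s)) (\<lambda>(t, x). \<phi>\<^sub>t r t * \<phi>\<^sub>x s x)"
    and bound: "\<And>r s. norm (tens r s) \<le> \<gamma> * norm r * norm s"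
  shows "bounded_bilinear tens"
proof -
  note D = function_space_on_def
  have inj: "v = w" if "agree_on m (S \<times> T) (\<phi> v) (\<phi> w)" for v w
    using V that unfolding D by blast
  have addV: "agree_on m (S \<times> T) (\<phi> (v + w)) (\<lambda>z. \<phi> v z + \<phi> w z)" for v w
    using V unfolding D by blast
  have scV: "agree_on m (S \<times> T) (\<phi> (c *\<^sub>R v)) (\<lambda>z. c * \<phi> v z)" for c v
    using V unfolding D by blast
  have addt: "agree_on m S (\<phi>\<^sub>t (v + w)) (\<lambda>z. \<phi>\<^sub>t v z + \<phi>\<^sub>t w z)"
    and sct: "agree_on m S (\<phi>\<^sub>t (c *\<^sub>R v)) (\<lambda>z. c * \<phi>\<^sub>t v z)" for c v w
    using Vt unfolding D by blast+
  have addx: "agree_on m T (\<phi>\<^sub>x (v + w)) (\<lambda>z. \<phi>\<^sub>x v z + \<phi>\<^sub>x w z)"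
    and scx: "agree_on m T (\<phi>\<^sub>x (c *\<^sub>R v)) (\<lambda>z. c * \<phi>\<^sub>x v z)" for c v w
    using Vx unfolding D by blast+
  have sum: "tens r s = tens r1 s1 + tens r2 s2"
    if "agree_on m (S \<times> T) (\<lambda>(t, x). \<phi>\<^sub>t r t * \<phi>\<^sub>x s x)
          (\<lambda>z. (case z of (t, x) \<Rightarrow> \<phi>\<^sub>t r1 t * \<phi>\<^sub>x s1 x) + (case z of (t, x) \<Rightarrow> \<phi>\<^sub>t r2 t * \<phi>\<^sub>x s2 x))"
    for r s r1 s1 r2 s2
  proof (rule inj)
    note tens
    also note that
    also note agree_on_sym[OF agree_on_combine[OF tens tens, where F = "(+)"]]
    also note agree_on_sym[OF addV]
    finally show "agree_on m (S \<times> T) (\<phi> (tens r s)) (\<phi> (tens r1 s1 + tens r2 s2))" .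
  qed
  have scale: "tens r s = c *\<^sub>R tens r1 s1"
    if "agree_on m (S \<times> T) (\<lambda>(t, x). \<phi>\<^sub>t r t * \<phi>\<^sub>x s x)
          (\<lambda>z. c * (case z of (t, x) \<Rightarrow> \<phi>\<^sub>t r1 t * \<phi>\<^sub>x s1 x))"
    for r s r1 s1 c
  proof (rule inj)
    note tens
    also note that
    \<comment> \<open>only the first of the two functions matters for a multiple\<close>
    also note agree_on_sym[OF agree_on_combine[OF tens tens, where F = "\<lambda>p q. c * p"]]
    also note agree_on_sym[OF scV]
    finally show "agree_on m (S \<times> T) (\<phi> (tens r s)) (\<phi> (c *\<^sub>R tens r1 s1))" .
  qed
  show ?thesis
  proof
    show "tens (a + a') b = tens a b + tens a' b" for a a' b
      using agree_on_tensor[OF addt[of a a'] agree_on_refl[of m T "\<phi>\<^sub>x b"]]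
      by (intro sum) (simp add: case_prod_beta' distrib_right)
    show "tens a (b + b') = tens a b + tens a b'" for a b b'
      using agree_on_tensor[OF agree_on_refl[of m S "\<phi>\<^sub>t a"] addx[of b b']]
      by (intro sum) (simp add: case_prod_beta' distrib_left)
    show "tens (c *\<^sub>R a) b = c *\<^sub>R tens a b" for c a b
      using agree_on_tensor[OF sct[of c a] agree_on_refl[of m T "\<phi>\<^sub>x b"]]
      by (intro scale) (simp add: case_prod_beta' mult.assoc)
    show "tens a (c *\<^sub>R b) = c *\<^sub>R tens a b" for a c b
      using agree_on_tensor[OF agree_on_refl[of m S "\<phi>\<^sub>t a"] scx[of c b]]
      by (intro scale) (simp add: case_prod_beta' mult.left_commute)
    show "\<exists>K. \<forall>a b. norm (tens a b) \<le> norm a * norm b * K"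
      using bound by (intro exI[of _ \<gamma>]) (simp add: mult_ac)
  qed
qed

section \<open>Sequences\<close>

lemma minimizing_sequence:
  fixes F :: "'a \<Rightarrow> real"
  assumes "\<And>y. b \<le> F y"
  obtains x I where "(\<lambda>n. F (x n)) \<longlonglongrightarrow> I" "\<And>y. I \<le> F y"
proof -
  define I where "I = (INF y. F y)"
  have bdd: "bdd_below (range F)"
    using assms by (intro bdd_belowI2)
  have I_le: "I \<le> F y" for y
    unfolding I_def by (rule cINF_lower[OF bdd UNIV_I])
  have "\<exists>y. F y < I + inverse (real (Suc n))" for n
    using cINF_less_iff[of UNIV F "I + inverse (real (Suc n))"] bdd by (simp add: I_def)
  then obtain x where x: "\<And>n. F (x n) < I + inverse (real (Suc n))"
    by metis
  have "(\<lambda>n. F (x n)) \<longlonglongrightarrow> I"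
  proof (rule real_tendsto_sandwich)
    show "\<forall>\<^sub>F n in sequentially. I \<le> F (x n)"
      by (rule always_eventually) (simp add: I_le)
    show "\<forall>\<^sub>F n in sequentially. F (x n) \<le> I + inverse (real (Suc n))"
      by (intro always_eventually allI less_imp_le x)
    show "(\<lambda>n. I + inverse (real (Suc n))) \<longlonglongrightarrow> I"
      using tendsto_add[OF tendsto_const LIMSEQ_inverse_real_of_nat] by simp
  qed simp
  then show ?thesis
    using that I_le by blast
qed

text \<open>Otherwise the sequence would dominate a multiple of the harmonic series.\<close>

lemma summable_liminf_index_times:
  fixes a :: "nat \<Rightarrow> real"
  assumes "summable a" "\<And>n. 0 \<le> a n" "e > 0"
  shows "\<exists>n\<ge>N. real n * a n < e"
proof (rule ccontr)
  assume "\<not> ?thesis"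
  then have *: "e \<le> real n * a n" if "n \<ge> N" for n
    using that by (meson not_le)
  have "summable (\<lambda>n. e * inverse (real n))"
  proof (rule summable_comparison_test[OF _ assms(1)])
    have "norm (e * inverse (real n)) \<le> a n" if "n \<ge> N" for n
      using *[OF that] assms(2)[of n] \<open>e > 0\<close> by (cases "n = 0") (auto simp: field_simps)
    then show "\<exists>N. \<forall>n\<ge>N. norm (e * inverse (real n)) \<le> a n" by blast
  qed
  then have "summable (\<lambda>n. inverse (real n))"
    using \<open>e > 0\<close> by (simp add: summable_cmult_iff)
  then show False
    using not_summable_harmonic[where 'a = real] by simp
qed

text \<open>For a bounded sequence, weak convergence to 0 need only be tested on a set with dense span.\<close>

lemma tendsto_inner_closure_span:
  fixes g :: "nat \<Rightarrow> 'a::real_inner"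
  assumes D: "\<And>y. y \<in> D \<Longrightarrow> (\<lambda>n. inner (g n) y) \<longlonglongrightarrow> 0"
    and bdd: "bounded (range g)" and u: "u \<in> closure (span D)"
  shows "(\<lambda>n. inner (g n) u) \<longlonglongrightarrow> 0"
proof (rule LIMSEQ_I)
  fix e :: real assume "e > 0"
  have span: "(\<lambda>n. inner (g n) y) \<longlonglongrightarrow> 0" if "y \<in> span D" for y
    using that
  proof (induction rule: span_induct_alt)
    case (step c x y)
    have "(\<lambda>n. c * inner (g n) x + inner (g n) y) \<longlonglongrightarrow> c * 0 + 0"
      by (intro tendsto_intros D step)
    then show ?case by (simp add: inner_add_right)
  qed simp
  obtain B where B: "B > 0" "\<And>n. norm (g n) \<le> B"
    using bdd by (auto simp: bounded_pos)
  obtain y where y: "y \<in> span D" "norm (y - u) < e / (2 * B)"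
    using u \<open>e > 0\<close> B(1) by (auto simp: closure_approachable dist_norm dest: spec[of _ "e / (2 * B)"])
  obtain N where N: "\<And>n. n \<ge> N \<Longrightarrow> \<bar>inner (g n) y\<bar> < e / 2"
    using LIMSEQ_D[OF span[OF y(1)], of "e / 2"] \<open>e > 0\<close> by auto
  have "\<bar>inner (g n) u\<bar> < e" if "n \<ge> N" for n
  proof -
    have "\<bar>inner (g n) (y - u)\<bar> \<le> norm (g n) * norm (y - u)"
      by (rule Cauchy_Schwarz_ineq2)
    also have "\<dots> \<le> B * (e / (2 * B))"
      using B y(2) by (intro mult_mono) auto
    also have "\<dots> = e / 2"
      using B(1) by simp
    finally show ?thesis
      using N[OF that] unfolding inner_diff_right by linarith
  qed
  then show "\<exists>N. \<forall>n\<ge>N. norm (inner (g n) u - 0) < e" by auto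
qed

section \<open>Strongly convex functionals on a Hilbert space\<close>

locale strongly_convex_functional =
  fixes E :: "'v::{real_inner,complete_space} \<Rightarrow> real" and E' :: "'v \<Rightarrow> 'v" and \<alpha> :: real
  assumes gradient: "\<And>v. GDERIV E v :> E' v"
    and \<alpha>_pos: "\<alpha> > 0"
    and strong_convexity: "\<And>v w. E w + inner (E' w) (v - w) + \<alpha> / 2 * (norm (v - w))\<^sup>2 \<le> E v"
begin

lemma tangent_below: "E w + inner (E' w) (v - w) \<le> E v"
proof -
  have "0 \<le> \<alpha> / 2 * (norm (v - w))\<^sup>2"
    using \<alpha>_pos by simp
  then show ?thesis
    using strong_convexity[of w v] by linarith
qed

lemma isCont_functional: "isCont E v"
  using gradient[of v] has_derivative_continuous unfolding gderiv_def by blast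

lemma directional_derivative:
  "((\<lambda>t. E (v + t *\<^sub>R h)) has_real_derivative inner (E' v) h) (at 0)"
proof -
  have E: "(E has_derivative (\<lambda>k. inner k (E' v))) (at (v + 0 *\<^sub>R h))"
    using gradient[of v] by (simp add: gderiv_def)
  have "((\<lambda>t. v + t *\<^sub>R h) has_derivative (\<lambda>t. 0 + t *\<^sub>R h)) (at 0)"
    by (intro has_derivative_add has_derivative_const bounded_linear_imp_has_derivative
        bounded_linear_scaleR_left)
  from has_derivative_compose[OF this E]
  have "((\<lambda>t. E (v + t *\<^sub>R h)) has_derivative (\<lambda>t. inner (t *\<^sub>R h) (E' v))) (at 0)"
    by simp
  moreover have "(\<lambda>t. inner (t *\<^sub>R h) (E' v)) = (*) (inner (E' v) h)"
    by (simp add: fun_eq_iff inner_commute)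
  ultimately show ?thesis
    by (simp add: has_field_derivative_def)
qed

lemma gradient_orthogonal_if_min_on_line:
  assumes "\<forall>\<^sub>F t in nhds 0. E v \<le> E (v + t *\<^sub>R h)"
  shows "inner (E' v) h = 0"
proof -
  obtain d where "d > 0" "\<And>t. dist t 0 < d \<Longrightarrow> E v \<le> E (v + t *\<^sub>R h)"
    using assms by (auto simp: eventually_nhds_metric)
  then show ?thesis
    using directional_derivative[of v h]
    by (intro DERIV_local_min[of "\<lambda>t. E (v + t *\<^sub>R h)" _ 0 d]) (auto simp: dist_real_def)
qed

lemma global_minimizer_iff_gradient_zero: "global_minimizer E v \<longleftrightarrow> E' v = 0"
proof
  assume "global_minimizer E v"
  then have "inner (E' v) (E' v) = 0"
    by (intro gradient_orthogonal_if_min_on_line) (simp add: global_minimizer_def)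
  then show "E' v = 0" by simp
next
  assume "E' v = 0"
  then show "global_minimizer E v"
    using tangent_below[of v] by (simp add: global_minimizer_def)
qed

text \<open>Coercivity: the quadratic term in the strong convexity inequality at 0 beats the linear one.\<close>

lemma bounded_sublevel: "bounded {v. E v \<le> c}"
proof -
  define A where "A = \<bar>c - E 0\<bar> + norm (E' 0)"
  have "norm v \<le> max 1 (2 * A / \<alpha>)" if "E v \<le> c" for v
  proof (cases "norm v \<le> 1")
    case False
    then have 1: "1 < norm v" by simp
    have "\<alpha> / 2 * (norm v)\<^sup>2 \<le> c - E 0 - inner (E' 0) v"
      using strong_convexity[of 0 v] that by simp
    also have "\<dots> \<le> \<bar>c - E 0\<bar> + norm (E' 0) * norm v"
      using Cauchy_Schwarz_ineq2[of "E' 0" v] by linarith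
    also have "\<dots> \<le> \<bar>c - E 0\<bar> * norm v + norm (E' 0) * norm v"
      using 1 mult_left_mono[of 1 "norm v" "\<bar>c - E 0\<bar>"] by simp
    also have "\<dots> = A * norm v"
      by (simp add: A_def distrib_right)
    finally have "(\<alpha> / 2 * norm v) * norm v \<le> A * norm v"
      by (simp add: power2_eq_square mult.assoc)
    then have "\<alpha> / 2 * norm v \<le> A"
      by (rule mult_right_le_imp_le) (use 1 in linarith)
    then have "norm v \<le> 2 * A / \<alpha>"
      using \<alpha>_pos by (simp add: field_simps)
    then show ?thesis by simp
  qed simp
  then show ?thesis
    unfolding bounded_iff by blast
qed

text \<open>On the bounded sublevel set of \<open>E 0\<close>, the tangent at 0 is a lower bound.\<close>

lemma bounded_below: "\<exists>b. \<forall>v. b \<le> E v"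
proof -
  have "bounded {v. E v \<le> E 0}" by (rule bounded_sublevel)
  then obtain R where R: "\<And>v. E v \<le> E 0 \<Longrightarrow> norm v \<le> R"
    unfolding bounded_iff by blast
  have "E 0 - norm (E' 0) * \<bar>R\<bar> \<le> E v" for v
  proof (cases "E v \<le> E 0")
    case True
    have "\<bar>inner (E' 0) v\<bar> \<le> norm (E' 0) * norm v"
      by (rule Cauchy_Schwarz_ineq2)
    also have "\<dots> \<le> norm (E' 0) * \<bar>R\<bar>"
      using R[OF True] by (intro mult_left_mono) auto
    finally show ?thesis
      using tangent_below[of 0 v] by simp
  next
    case False
    have "0 \<le> norm (E' 0) * \<bar>R\<bar>" by simp
    with False show ?thesis by linarith
  qed
  then show ?thesis by blast
qed

lemma midpoint_strong_convexity:
  "\<alpha> / 4 * (norm (v - w))\<^sup>2 \<le> E v + E w - 2 * E ((1/2) *\<^sub>R (v + w))"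
proof -
  define c where "c = (1/2) *\<^sub>R (v + w)"
  have v: "v - c = (1/2) *\<^sub>R (v - w)" and w: "w - c = - ((1/2) *\<^sub>R (v - w))"
    unfolding c_def by (auto simp: algebra_simps simp flip: scaleR_add_left)
  have "(norm (v - c))\<^sup>2 = (norm (v - w))\<^sup>2 / 4" "(norm (w - c))\<^sup>2 = (norm (v - w))\<^sup>2 / 4"
    unfolding v w by (simp_all add: power_divide)
  then show ?thesis
    using strong_convexity[of c v] strong_convexity[of c w]
    unfolding v w c_def[symmetric] by (simp add: power_divide)
qed

text \<open>By midpoint convexity the distance of two almost-minimizers is controlled by their excess energy,
  so a minimizing sequence is Cauchy.\<close>

lemma ex1_global_minimizer: "\<exists>!u. global_minimizer E u"
proof (rule ex_ex1I)
  obtain b where b: "\<And>v. b \<le> E v" using bounded_below by blast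
  obtain x I where x: "(\<lambda>n. E (x n)) \<longlonglongrightarrow> I" and I_le: "\<And>v. I \<le> E v"
    using minimizing_sequence[of b E] b by blast
  have "Cauchy x"
  proof (rule metric_CauchyI)
    fix e :: real assume "e > 0"
    \<comment> \<open>chosen so that \<open>\<alpha> / 4 * e\<^sup>2 = 2 * \<delta>\<close>, the bound on the excess of a pair\<close>
    define \<delta> where "\<delta> = \<alpha> * e\<^sup>2 / 8"
    have "\<delta> > 0" using \<open>e > 0\<close> \<alpha>_pos by (simp add: \<delta>_def)
    then obtain N where N: "\<And>n. n \<ge> N \<Longrightarrow> E (x n) < I + \<delta>"
      using order_tendstoD(2)[OF x, of "I + \<delta>"] by (auto simp: eventually_sequentially)
    have "dist (x i) (x j) < e" if "i \<ge> N" "j \<ge> N" for i j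
    proof -
      have "\<alpha> / 4 * (norm (x i - x j))\<^sup>2 < 2 * \<delta>"
        using midpoint_strong_convexity[of "x i" "x j"] N[OF that(1)] N[OF that(2)]
          I_le[of "(1/2) *\<^sub>R (x i + x j)"] by linarith
      then have "(norm (x i - x j))\<^sup>2 < e\<^sup>2"
        using \<alpha>_pos by (simp add: \<delta>_def)
      then show ?thesis
        using \<open>e > 0\<close> by (simp add: dist_norm power_less_imp_less_base)
    qed
    then show "\<exists>M. \<forall>m\<ge>M. \<forall>n\<ge>M. dist (x m) (x n) < e" by blast
  qed
  then obtain u where "x \<longlonglongrightarrow> u"
    by (meson Cauchy_convergent convergent_def)
  then have "(\<lambda>n. E (x n)) \<longlonglongrightarrow> E u"
    by (rule isCont_tendsto_compose[OF isCont_functional])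
  with x have "E u = I"
    using LIMSEQ_unique by blast
  with I_le show "\<exists>u. global_minimizer E u"
    by (auto simp: global_minimizer_def)
next
  fix u v assume uv: "global_minimizer E u" "global_minimizer E v"
  have "\<alpha> / 2 * (norm (v - u))\<^sup>2 \<le> E v - E u"
    using strong_convexity[of u v] uv(1) by (simp add: global_minimizer_iff_gradient_zero)
  also have "\<dots> \<le> 0"
    using uv(2) by (simp add: global_minimizer_def)
  finally show "u = v"
    using \<alpha>_pos by (simp add: mult_le_0_iff)
qed

text \<open>The tangent at the weak limit is a minorant of \<open>E\<close> whose values along the sequence converge.\<close>

lemma weakly_lower_semicontinuous:
  assumes "weakly_converges_to x l" "(\<lambda>n. E (w + x n)) \<longlonglongrightarrow> I"
  shows "E (w + l) \<le> I"
proof -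
  let ?g = "E' (w + l)"
  have "(\<lambda>n. inner ?g (x n)) \<longlonglongrightarrow> inner ?g l"
    using assms(1) bounded_linear_inner_right unfolding weakly_converges_to_def by blast
  then have lim: "(\<lambda>n. E (w + l) + (inner ?g (x n) - inner ?g l))
      \<longlonglongrightarrow> E (w + l) + (inner ?g l - inner ?g l)"
    by (intro tendsto_add tendsto_diff tendsto_const)
  have "E (w + l) + (inner ?g (x n) - inner ?g l) \<le> E (w + x n)" for n
    using tangent_below[of "w + l" "w + x n"] by (simp add: inner_diff_right inner_add_right)
  then show ?thesis
    using LIMSEQ_le[OF lim assms(2)] by simp
qed

section \<open>Convergence of greedy sums over a dictionary\<close>

text \<open>The convergence argument does not see the tensor structure: it applies to sums of elements of any
  set \<open>D\<close> with dense span, as soon as each summand is orthogonal to the gradient reached with it and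
  its norm controls that gradient on \<open>D\<close>.\<close>

lemma greedy_sums_converge:
  fixes z :: "nat \<Rightarrow> 'v" and D :: "'v set"
  defines "U \<equiv> \<lambda>n. \<Sum>k=1..n. z k"
  assumes dense: "closure (span D) = UNIV"
    and z: "\<And>n. n \<ge> 1 \<Longrightarrow> z n \<in> D"
    and orth: "\<And>n. n \<ge> 1 \<Longrightarrow> inner (E' (U n)) (z n) = 0"
    and dual: "\<And>n y. n \<ge> 1 \<Longrightarrow> y \<in> D \<Longrightarrow> \<bar>inner (E' (U n)) y\<bar> \<le> C * norm (z n) * norm y"
    and bdd: "bounded (range (\<lambda>n. E' (U n)))"
    and u: "global_minimizer E u"
  shows "U \<longlonglongrightarrow> u"
proof -
  have U_Suc: "U (Suc n) = U n + z (Suc n)" for n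
    by (simp add: U_def)
  have decr: "\<alpha> / 2 * (norm (z (Suc n)))\<^sup>2 \<le> E (U n) - E (U (Suc n))" for n
    using strong_convexity[of "U (Suc n)" "U n"] orth[of "Suc n"] by (simp add: U_Suc)
  have anti: "E (U n) \<le> E (U k)" if "k \<le> n" for k n
  proof (rule lift_Suc_antimono_le[OF _ that, of "\<lambda>n. E (U n)"])
    show "E (U (Suc n)) \<le> E (U n)" for n
      using decr[of n] \<alpha>_pos by (smt (verit) mult_nonneg_nonneg zero_le_power2 half_gt_zero)
  qed
  define a where "a n = (norm (z n))\<^sup>2" for n
  have partial: "\<alpha> / 2 * (\<Sum>k=1..n. a k) \<le> E 0 - E u" for n
  proof -
    have "\<alpha> / 2 * (\<Sum>k=1..n. a k) \<le> E (U 0) - E (U n)"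
    proof (induction n)
      case (Suc n)
      then show ?case using decr[of n] by (simp add: a_def distrib_left)
    qed simp
    also have "\<dots> \<le> E 0 - E u"
      using u by (simp add: U_def global_minimizer_def)
    finally show ?thesis .
  qed
  define S where "S = 2 * (E 0 - E u) / \<alpha>"
  have S: "(\<Sum>k=1..n. a k) \<le> S" for n
    using partial[of n] \<alpha>_pos by (simp add: S_def field_simps)
  have "summable (\<lambda>n. a (Suc n))"
  proof (rule bounded_imp_summable)
    fix n
    have "(\<Sum>k\<le>n. a (Suc k)) = (\<Sum>k=1..Suc n. a k)"
      using sum.shift_bounds_cl_Suc_ivl[of a 0 n] by (simp add: atLeast0AtMost)
    then show "(\<Sum>k\<le>n. a (Suc k)) \<le> S"
      using S[of "Suc n"] by simp
  qed (simp add: a_def)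
  then have a: "summable a"
    by (simp add: summable_Suc_iff)
  have z0: "(\<lambda>n. norm (z n)) \<longlonglongrightarrow> 0"
    using tendsto_real_sqrt[OF summable_LIMSEQ_zero[OF a]] by (simp add: a_def)
  have pointwise: "(\<lambda>n. inner (E' (U n)) y) \<longlonglongrightarrow> 0" if "y \<in> D" for y
  proof (rule Lim_null_comparison)
    show "(\<lambda>n. C * norm (z n) * norm y) \<longlonglongrightarrow> 0"
      using tendsto_mult_right_zero[OF z0, of "C * norm y"] by (simp add: mult_ac)
    show "\<forall>\<^sub>F n in sequentially. norm (inner (E' (U n)) y) \<le> C * norm (z n) * norm y"
      using dual that by (auto simp: eventually_sequentially)
  qed
  have weak: "(\<lambda>n. inner (E' (U n)) u) \<longlonglongrightarrow> 0"
    by (rule tendsto_inner_closure_span[where D = D, OF pointwise bdd]) (simp_all add: dense)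
  \<comment> \<open>the dual bound for each \<open>z k\<close>, then Cauchy-Schwarz for the sum of the norms\<close>
  have self: "\<bar>inner (E' (U n)) (U n)\<bar> \<le> \<bar>C\<bar> * sqrt (S * (real n * a n))" if "n \<ge> 1" for n
  proof -
    have "\<bar>inner (E' (U n)) (U n)\<bar> \<le> (\<Sum>k=1..n. \<bar>inner (E' (U n)) (z k)\<bar>)"
      by (subst (2) U_def) (simp add: inner_sum_right sum_abs)
    also have "\<dots> \<le> (\<Sum>k=1..n. \<bar>C\<bar> * norm (z n) * norm (z k))"
    proof (rule sum_mono)
      fix k assume "k \<in> {1..n}"
      then have "\<bar>inner (E' (U n)) (z k)\<bar> \<le> C * norm (z n) * norm (z k)"
        using dual z that by simp
      also have "\<dots> \<le> \<bar>C\<bar> * norm (z n) * norm (z k)"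
        by (intro mult_right_mono) auto
      finally show "\<bar>inner (E' (U n)) (z k)\<bar> \<le> \<bar>C\<bar> * norm (z n) * norm (z k)" .
    qed
    also have "\<dots> = \<bar>C\<bar> * (norm (z n) * (\<Sum>k=1..n. norm (z k)))"
      by (simp add: sum_distrib_left mult.assoc)
    also have "\<dots> \<le> \<bar>C\<bar> * sqrt (S * (real n * a n))"
    proof (intro mult_left_mono real_le_rsqrt)
      have "(\<Sum>k=1..n. norm (z k))\<^sup>2 \<le> real n * (\<Sum>k=1..n. a k)"
        using sum_squared_le_sum_of_squares[of "\<lambda>k. norm (z k)" "{1..n}"]
        by (simp add: a_def mult.commute)
      also have "\<dots> \<le> real n * S"
        by (intro mult_left_mono S) simp
      finally have "a n * (\<Sum>k=1..n. norm (z k))\<^sup>2 \<le> a n * (real n * S)"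
        by (intro mult_left_mono) (auto simp: a_def)
      then show "(norm (z n) * (\<Sum>k=1..n. norm (z k)))\<^sup>2 \<le> S * (real n * a n)"
        by (simp add: power_mult_distrib a_def mult_ac)
    qed simp
    finally show ?thesis .
  qed
  have gap: "\<exists>n. E (U n) - E u < e" if "e > 0" for e
  proof -
    obtain N where N: "\<And>n. n \<ge> N \<Longrightarrow> \<bar>inner (E' (U n)) u\<bar> < e / 2"
      using LIMSEQ_D[OF weak, of "e / 2"] \<open>e > 0\<close> by auto
    \<comment> \<open>makes the bound \<open>self\<close> at most \<open>e / 2\<close>; adding 1 avoids division by zero\<close>
    define \<delta> where "\<delta> = (e / (2 * (\<bar>C\<bar> + 1)))\<^sup>2 / (\<bar>S\<bar> + 1)"
    have "\<delta> > 0" using \<open>e > 0\<close> by (simp add: \<delta>_def)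
    then obtain n where n: "n \<ge> max 1 N" "real n * a n < \<delta>"
      using summable_liminf_index_times[OF a, of \<delta> "max 1 N"] by (auto simp: a_def)
    have "S * (real n * a n) \<le> (\<bar>S\<bar> + 1) * (real n * a n)"
      by (intro mult_right_mono) (auto simp: a_def)
    also have "\<dots> \<le> (\<bar>S\<bar> + 1) * \<delta>"
      using n(2) by (intro mult_left_mono) auto
    also have "\<dots> = (e / (2 * (\<bar>C\<bar> + 1)))\<^sup>2"
      by (simp add: \<delta>_def)
    finally have "sqrt (S * (real n * a n)) \<le> e / (2 * (\<bar>C\<bar> + 1))"
      using \<open>e > 0\<close> by (intro real_le_lsqrt) auto
    then have "\<bar>C\<bar> * sqrt (S * (real n * a n)) \<le> \<bar>C\<bar> * (e / (2 * (\<bar>C\<bar> + 1)))"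
      by (intro mult_left_mono) auto
    also have "\<dots> \<le> e / 2"
      using \<open>e > 0\<close> by (simp add: field_simps)
    finally have "\<bar>inner (E' (U n)) (U n)\<bar> \<le> e / 2"
      using self[of n] n(1) by simp
    moreover have "\<bar>inner (E' (U n)) u\<bar> < e / 2"
      using N n(1) by simp
    moreover have "E (U n) - E u \<le> inner (E' (U n)) (U n) - inner (E' (U n)) u"
      using tangent_below[of "U n" u] by (simp add: inner_diff_right)
    ultimately show ?thesis by (intro exI[of _ n]) linarith
  qed
  show ?thesis
  proof (rule metric_LIMSEQ_I)
    fix e :: real assume "e > 0"
    then obtain N where N: "E (U N) - E u < \<alpha> / 2 * e\<^sup>2"
      using gap[of "\<alpha> / 2 * e\<^sup>2"] \<alpha>_pos by auto
    have "dist (U n) u < e" if "n \<ge> N" for n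
    proof -
      have "\<alpha> / 2 * (norm (U n - u))\<^sup>2 \<le> E (U n) - E u"
        using strong_convexity[of u "U n"] u by (simp add: global_minimizer_iff_gradient_zero)
      also have "\<dots> < \<alpha> / 2 * e\<^sup>2"
        using anti[OF that] N by linarith
      finally have "(norm (U n - u))\<^sup>2 < e\<^sup>2"
        using \<alpha>_pos by simp
      then show ?thesis
        using \<open>e > 0\<close> by (simp add: dist_norm power_less_imp_less_base)
    qed
    then show "\<exists>N. \<forall>n\<ge>N. dist (U n) u < e" by blast
  qed
qed

end

section \<open>Existence of a decreasing step\<close>

locale tensor_greedy = strongly_convex_functional E E' \<alpha> + bounded_bilinear tens
  for E :: "'v::{real_inner,complete_space} \<Rightarrow> real" and E' \<alpha>
    and tens :: "'vt::real_normed_vector \<Rightarrow> 'vx::real_normed_vector \<Rightarrow> 'v" +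
  assumes dense: "closure (span (simple_tensors tens)) = UNIV"
begin

lemma gradient_zero_if_orthogonal_to_tensors:
  assumes "\<And>r s. inner (E' w) (tens r s) = 0"
  shows "E' w = 0"
proof -
  have tensors: "(\<lambda>n::nat. inner (E' w) y) \<longlonglongrightarrow> 0" if "y \<in> simple_tensors tens" for y
    using that assms by (auto simp: simple_tensors_def)
  have "(\<lambda>n::nat. inner (E' w) (E' w)) \<longlonglongrightarrow> 0"
    by (rule tendsto_inner_closure_span[where D = "simple_tensors tens", OF tensors])
      (simp_all add: dense)
  then show ?thesis by (simp add: LIMSEQ_const_iff)
qed

text \<open>Multiples of a simple tensor are simple tensors, so if none of them decreases the energy, then the
  gradient is orthogonal to each.\<close>

lemma ex_strictly_decreasing_tensor:
  assumes "\<not> global_minimizer E w"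
  shows "\<exists>r s. E (w + tens r s) < E w"
proof (rule ccontr)
  assume "\<not> ?thesis"
  then have *: "E w \<le> E (w + tens r s)" for r s
    by (simp add: not_less)
  have "inner (E' w) (tens r s) = 0" for r s
  proof (rule gradient_orthogonal_if_min_on_line)
    show "\<forall>\<^sub>F t in nhds 0. E w \<le> E (w + t *\<^sub>R tens r s)"
      using *[of "_ *\<^sub>R r" s] by (simp add: scaleR_left)
  qed
  then have "E' w = 0" by (rule gradient_zero_if_orthogonal_to_tensors)
  with assms show False
    by (simp add: global_minimizer_iff_gradient_zero)
qed

text \<open>The direct method of the calculus of variations. The factors of a minimizing sequence may be
  unbounded, but their tensor products are bounded, and the hypothesis keeps a weak limit among
  the simple tensors.\<close>

lemma ex_best_tensor:
  assumes compact: "\<And>v::nat \<Rightarrow> 'v. range v \<subseteq> simple_tensors tens \<Longrightarrow> bounded (range v) \<Longrightarrow>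
      \<exists>l\<in>simple_tensors tens. \<exists>\<sigma>::nat \<Rightarrow> nat. strict_mono \<sigma> \<and> weakly_converges_to (v \<circ> \<sigma>) l"
  shows "\<exists>r s. \<forall>r' s'. E (w + tens r s) \<le> E (w + tens r' s')"
proof -
  define F where "F = (\<lambda>(r, s). E (w + tens r s))"
  obtain b where b: "\<And>v. b \<le> E v" using bounded_below by blast
  then have Fb: "b \<le> F y" for y by (simp add: F_def case_prod_beta)
  obtain y I where y: "(\<lambda>n. F (y n)) \<longlonglongrightarrow> I" and I_le: "\<And>y. I \<le> F y"
    using minimizing_sequence[of b F] Fb by blast
  define v where "v n = tens (fst (y n)) (snd (y n))" for n
  have F_v: "F (y n) = E (w + v n)" for n
    by (simp add: F_def v_def case_prod_beta)
  have "Bseq (\<lambda>n. F (y n))"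
    using y convergent_def convergent_imp_Bseq by blast
  then obtain c where "\<And>n. norm (F (y n)) \<le> c"
    by (auto simp: Bseq_def)
  then have c: "E (w + v n) \<le> c" for n
    by (metis F_v abs_le_D1 real_norm_def)
  obtain R where R: "\<And>x. E x \<le> c \<Longrightarrow> norm x \<le> R"
    using bounded_sublevel[of c] unfolding bounded_iff by blast
  have "norm (v n) \<le> R + norm w" for n
    using R[OF c, of n] norm_triangle_ineq4[of "w + v n" w] by simp
  then have "bounded (range v)"
    unfolding bounded_iff by blast
  moreover have "range v \<subseteq> simple_tensors tens"
    by (auto simp: v_def simple_tensors_def)
  ultimately obtain l \<sigma> where l: "l \<in> simple_tensors tens"
    and \<sigma>: "strict_mono (\<sigma> :: nat \<Rightarrow> nat)" "weakly_converges_to (v \<circ> \<sigma>) l"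
    using compact by blast
  obtain r s where rs: "l = tens r s"
    using l by (auto simp: simple_tensors_def)
  have "(\<lambda>n. E (w + (v \<circ> \<sigma>) n)) \<longlonglongrightarrow> I"
    using LIMSEQ_subseq_LIMSEQ[OF y \<sigma>(1)] by (simp add: F_v o_def)
  then have "E (w + l) \<le> I"
    by (rule weakly_lower_semicontinuous[OF \<sigma>(2)])
  then have "E (w + tens r s) \<le> E (w + tens r' s')" for r' s'
    using I_le[of "(r', s')"] by (simp add: F_def rs)
  then show ?thesis by blast
qed

lemma ex_greedy_step:
  assumes compact: "\<And>v::nat \<Rightarrow> 'v. range v \<subseteq> simple_tensors tens \<Longrightarrow> bounded (range v) \<Longrightarrow>
      \<exists>l\<in>simple_tensors tens. \<exists>\<sigma>::nat \<Rightarrow> nat. strict_mono \<sigma> \<and> weakly_converges_to (v \<circ> \<sigma>) l"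
    and "\<not> global_minimizer E w"
  shows "\<exists>r s. greedy_step E tens w r s"
proof -
  obtain r s where best: "\<And>r' s'. E (w + tens r s) \<le> E (w + tens r' s')"
    using ex_best_tensor[OF compact] by blast
  moreover obtain r' s' where "E (w + tens r' s') < E w"
    using ex_strictly_decreasing_tensor[OF assms(2)] by blast
  ultimately have "E (w + tens r s) < E w"
    by (meson le_less_trans)
  with best have "greedy_step E tens w r s"
    by (auto simp: greedy_step_def local_minimizer_def intro!: always_eventually)
  then show ?thesis by blast
qed

section \<open>Optimality conditions at a local minimizer\<close>

lemma greedy_step_eventually:
  assumes "greedy_step E tens w r s"
  shows "\<forall>\<^sub>F c in nhds (0::real). E (w + tens r s) \<le> E (w + tens (r + c *\<^sub>R a) (s + c *\<^sub>R b))"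
proof -
  have "\<forall>\<^sub>F y in nhds (r, s). E (w + tens r s) \<le> (case y of (r', s') \<Rightarrow> E (w + tens r' s'))"
    using assms by (simp add: greedy_step_def local_minimizer_def)
  moreover have "((\<lambda>c. (r + c *\<^sub>R a, s + c *\<^sub>R b)) \<longlongrightarrow> (r + 0 *\<^sub>R a, s + 0 *\<^sub>R b)) (nhds 0)"
    by (intro tendsto_intros filterlim_ident)
  then have "((\<lambda>c. (r + c *\<^sub>R a, s + c *\<^sub>R b)) \<longlongrightarrow> (r, s)) (nhds 0)"
    by simp
  ultimately show ?thesis
    by (auto dest: eventually_compose_filterlim)
qed

text \<open>Moving one factor only moves the tensor product along a line.\<close>

lemma greedy_step_orthogonal:
  assumes step: "greedy_step E tens w r s"
  shows "inner (E' (w + tens r s)) (tens a s) = 0" "inner (E' (w + tens r s)) (tens r b) = 0"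
  using greedy_step_eventually[OF step, of a 0] greedy_step_eventually[OF step, of 0 b]
  by (auto intro!: gradient_orthogonal_if_min_on_line
      simp: add_left add_right scaleR_left scaleR_right zero_right zero_left add.assoc)

text \<open>Both factors are moved simultaneously, by \<open>c *\<^sub>R a\<close> and \<open>c *\<^sub>R b\<close>. The directions have the norms of
  the factors so that the squared displacement is at most \<open>9 * c\<^sup>2 * (\<gamma> * norm r * norm s)\<^sup>2\<close>, of the
  same order in \<open>c\<close> as the mixed term. A single small \<open>c\<close> suffices.\<close>

lemma greedy_step_gradient_lower_bound:
  assumes step: "greedy_step E tens w r s"
    and lip: "\<And>x y. x \<in> cball 0 R \<Longrightarrow> y \<in> cball 0 R \<Longrightarrow> norm (E' x - E' y) \<le> L * norm (x - y)"
    and v: "norm (w + tens r s) < R"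
    and L: "L \<ge> 0"
    and bound: "\<And>r s. norm (tens r s) \<le> \<gamma> * norm r * norm s"
    and ab: "norm a = norm r" "norm b = norm s"
  shows "- inner (E' (w + tens r s)) (tens a b) \<le> 9 * L * (\<gamma> * norm r * norm s)\<^sup>2"
proof -
  define v where "v = w + tens r s"
  define h where "h c = c *\<^sub>R (tens a s + tens r b) + c\<^sup>2 *\<^sub>R tens a b" for c :: real
  define q where "q = \<gamma> * norm r * norm s"
  have vh: "w + tens (r + c *\<^sub>R a) (s + c *\<^sub>R b) = v + h c" for c
    by (simp add: v_def h_def add_left add_right scaleR_left scaleR_right scaleR_add_right
        power2_eq_square)
  have "((\<lambda>c. norm (v + h c)) \<longlongrightarrow> norm (v + h 0)) (nhds 0)"
    unfolding h_def by (intro tendsto_intros filterlim_ident)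
  then have "\<forall>\<^sub>F c in nhds 0. norm (v + h c) < R"
    by (rule order_tendstoD) (use v in \<open>simp add: h_def v_def\<close>)
  with greedy_step_eventually[OF step, of a b]
  have "\<forall>\<^sub>F c in nhds 0. E v \<le> E (v + h c) \<and> norm (v + h c) < R"
    by eventually_elim (simp add: vh v_def[symmetric])
  then obtain d where d: "d > 0"
    "\<And>c. dist c 0 < d \<Longrightarrow> E v \<le> E (v + h c) \<and> norm (v + h c) < R"
    unfolding eventually_nhds_metric by blast
  define c where "c = min 1 (d / 2)"
  have c: "0 < c" "c \<le> 1" "E v \<le> E (v + h c)" "norm (v + h c) < R"
    using d by (auto simp: c_def dist_real_def)
  have "norm (tens a s + tens r b) \<le> 2 * q"
    using norm_triangle_ineq[of "tens a s" "tens r b"] bound[of a s] bound[of r b]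
    by (simp add: ab q_def)
  then have "c * norm (tens a s + tens r b) \<le> c * (2 * q)"
    using c(1) by (intro mult_left_mono) auto
  moreover have "c\<^sup>2 * norm (tens a b) \<le> c * q"
    using c bound[of a b] by (intro mult_mono) (auto simp: ab q_def power2_eq_square mult_left_le)
  moreover have "norm (h c) \<le> c * norm (tens a s + tens r b) + c\<^sup>2 * norm (tens a b)"
    using norm_triangle_ineq[of "c *\<^sub>R (tens a s + tens r b)" "c\<^sup>2 *\<^sub>R tens a b"] c(1)
    by (simp add: h_def)
  ultimately have norm_h: "norm (h c) \<le> 3 * c * q"
    by linarith
  \<comment> \<open>convexity with the tangent at the displaced point gives a Taylor estimate without integration\<close>
  have "0 \<le> inner (E' (v + h c)) (h c)"
    using tangent_below[of "v + h c" v] c(3) by (simp add: inner_minus_right)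
  also have "\<dots> = inner (E' v) (h c) + inner (E' (v + h c) - E' v) (h c)"
    by (simp add: inner_diff_left)
  also have "inner (E' v) (h c) = c\<^sup>2 * inner (E' v) (tens a b)"
    using greedy_step_orthogonal[OF step] by (simp add: h_def v_def inner_add_right)
  also have "inner (E' (v + h c) - E' v) (h c) \<le> norm (E' (v + h c) - E' v) * norm (h c)"
    by (rule norm_cauchy_schwarz)
  also have "\<dots> \<le> L * norm (h c) * norm (h c)"
    using lip[of "v + h c" v] c(4) v by (intro mult_right_mono) (auto simp: v_def)
  also have "\<dots> = L * (norm (h c))\<^sup>2"
    by (simp add: power2_eq_square)
  also have "\<dots> \<le> L * (3 * c * q)\<^sup>2"
    using L norm_h by (intro mult_left_mono power_mono) auto
  finally have "0 \<le> c\<^sup>2 * (inner (E' v) (tens a b) + 9 * L * q\<^sup>2)"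
    by (simp add: power_mult_distrib algebra_simps)
  then have "0 \<le> inner (E' v) (tens a b) + 9 * L * q\<^sup>2"
    using c(1) by (simp add: zero_le_mult_iff)
  then show ?thesis by (simp add: v_def q_def)
qed

text \<open>The sign is removed by passing to \<open>- b\<close>, and the restriction on the norms by homogeneity. Strict
  decrease makes both factors nonzero, so that the factor \<open>norm r * norm s\<close> picked up by rescaling
  can be cancelled.\<close>

lemma greedy_step_gradient_bound:
  assumes step: "greedy_step E tens w r s"
    and lip: "\<And>x y. x \<in> cball 0 R \<Longrightarrow> y \<in> cball 0 R \<Longrightarrow> norm (E' x - E' y) \<le> L * norm (x - y)"
    and v: "norm (w + tens r s) < R"
    and L: "L \<ge> 0"
    and bound: "\<And>r s. norm (tens r s) \<le> \<gamma> * norm r * norm s"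
  shows "\<bar>inner (E' (w + tens r s)) (tens a b)\<bar>
    \<le> 9 * L * \<gamma>\<^sup>2 * (norm r * norm s) * (norm a * norm b)"
proof (cases "norm a * norm b = 0")
  case True
  then show ?thesis by (auto simp: zero_left zero_right)
next
  case False
  define g where "g = E' (w + tens r s)"
  define p where "p = norm r * norm s"
  define q where "q = norm a * norm b"
  have "tens r s \<noteq> 0"
    using step by (auto simp: greedy_step_def)
  then have "r \<noteq> 0" "s \<noteq> 0"
    by (auto simp: zero_left zero_right)
  then have p: "p > 0"
    by (simp add: p_def)
  have q: "q > 0" using False by (simp add: q_def)
  define a1 where "a1 = (norm r / norm a) *\<^sub>R a"
  define b1 where "b1 = (norm s / norm b) *\<^sub>R b"
  have n: "norm a1 = norm r" "norm b1 = norm s" "norm (- b1) = norm s"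
    using False by (auto simp: a1_def b1_def)
  have "\<bar>inner g (tens a1 b1)\<bar> \<le> 9 * L * (\<gamma> * norm r * norm s)\<^sup>2"
    using greedy_step_gradient_lower_bound[OF step lip v L bound n(1,2)]
      greedy_step_gradient_lower_bound[OF step lip v L bound n(1,3)]
    by (simp add: g_def minus_right)
  also have "inner g (tens a1 b1) = p / q * inner g (tens a b)"
    by (simp add: a1_def b1_def p_def q_def scaleR_left scaleR_right mult_ac)
  finally have "p * (\<bar>inner g (tens a b)\<bar> / q) \<le> p * (9 * L * \<gamma>\<^sup>2 * p)"
    using p q by (simp add: abs_mult power_mult_distrib p_def power2_eq_square mult_ac)
  then have "\<bar>inner g (tens a b)\<bar> / q \<le> 9 * L * \<gamma>\<^sup>2 * p"
    using p by (simp only: mult_le_cancel_left_pos)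
  then show ?thesis
    using q by (simp add: g_def p_def[symmetric] q_def[symmetric] pos_divide_le_eq)
qed

section \<open>Convergence of the iterates\<close>

text \<open>The lower bound with \<open>\<beta>\<close> converts the products of the norms of the factors into norms of
  tensors. Iterations at which the algorithm stops satisfy the same estimates, since there the gradient
  is zero.\<close>

lemma greedy_iterates_converge:
  assumes lip: "\<And>K. bounded K \<Longrightarrow> \<exists>L\<ge>0. \<forall>v\<in>K. \<forall>w\<in>K. norm (E' v - E' w) \<le> L * norm (v - w)"
    and \<beta>: "\<beta> > 0" "\<And>r s. \<beta> * norm r * norm s \<le> norm (tens r s)"
    and \<gamma>: "\<And>r s. norm (tens r s) \<le> \<gamma> * norm r * norm s"
    and iter: "\<And>n. n \<ge> 1 \<Longrightarrow> greedy_iteration E tens r s n"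
    and u: "global_minimizer E u"
  shows "greedy_sum tens r s \<longlonglongrightarrow> u"
proof -
  let ?U = "greedy_sum tens r s"
  let ?z = "\<lambda>n. tens (r n) (s n)"
  have U: "(\<Sum>k=1..n. ?z k) = ?U n" for n
    by (simp add: greedy_sum_def)
  have U_Suc: "?U (Suc n) = ?U n + ?z (Suc n)" for n
    by (simp add: greedy_sum_def)
  have step: "greedy_step E tens (?U n) (r (Suc n)) (s (Suc n)) \<or>
      E' (?U (Suc n)) = 0 \<and> ?z (Suc n) = 0" for n
    using iter[of "Suc n"]
    by (auto simp: greedy_iteration_def U_Suc global_minimizer_iff_gradient_zero)
  have "E (?U n) \<le> E 0" for n
  proof (induction n)
    case (Suc n)
    then show ?case
      using step[of n] by (auto simp: greedy_step_def U_Suc)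
  qed (simp add: greedy_sum_def)
  then obtain R0 where R0: "\<And>n. norm (?U n) \<le> R0"
    using bounded_sublevel[of "E 0"] unfolding bounded_iff by blast
  define R where "R = R0 + 1"
  have R: "norm (?U n) < R" for n
    using R0[of n] by (simp add: R_def)
  obtain L where L: "L \<ge> 0"
    and Lip: "\<And>x y. x \<in> cball 0 R \<Longrightarrow> y \<in> cball 0 R \<Longrightarrow> norm (E' x - E' y) \<le> L * norm (x - y)"
    using lip[OF bounded_cball] by metis
  define C where "C = 9 * L * \<gamma>\<^sup>2 / \<beta>\<^sup>2"
  have "(\<lambda>n. \<Sum>k=1..n. ?z k) \<longlonglongrightarrow> u"
  proof (rule greedy_sums_converge[where z = ?z and C = C and D = "simple_tensors tens",
        OF dense _ _ _ _ u], unfold U)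
    show "?z n \<in> simple_tensors tens" for n
      by (auto simp: simple_tensors_def)
  next
    fix n :: nat assume "n \<ge> 1"
    then obtain k where k: "n = Suc k" by (cases n) auto
    show "inner (E' (?U n)) (?z n) = 0"
      using step[of k] greedy_step_orthogonal(1) by (auto simp: k U_Suc)
  next
    fix n :: nat and y assume "n \<ge> 1" and "y \<in> simple_tensors tens"
    then obtain k a b where k: "n = Suc k" and y: "y = tens a b"
      by (cases n) (auto simp: simple_tensors_def)
    show "\<bar>inner (E' (?U n)) y\<bar> \<le> C * norm (?z n) * norm y"
      using step[of k]
    proof
      assume gs: "greedy_step E tens (?U k) (r (Suc k)) (s (Suc k))"
      have \<beta>': "norm p * norm q \<le> norm (tens p q) / \<beta>" for p q
        using \<beta>(1) \<beta>(2)[of p q] by (simp add: field_simps)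
      have "\<bar>inner (E' (?U n)) y\<bar> \<le>
          9 * L * \<gamma>\<^sup>2 * ((norm (r n) * norm (s n)) * (norm a * norm b))"
        using greedy_step_gradient_bound[where a = a and b = b and R = R, OF gs Lip _ L \<gamma>] R[of n]
        by (simp add: k y U_Suc mult.assoc)
      also have "\<dots> \<le> 9 * L * \<gamma>\<^sup>2 * ((norm (?z n) / \<beta>) * (norm y / \<beta>))"
        unfolding y using L \<beta>(1) by (intro mult_left_mono mult_mono \<beta>') auto
      also have "\<dots> = C * norm (?z n) * norm y"
        by (simp add: C_def power2_eq_square)
      finally show ?thesis .
    qed (simp add: k)
  next
    have "norm (E' (?U n)) \<le> L * (2 * R) + norm (E' (?U 0))" for n
    proof -
      have "norm (E' (?U n) - E' (?U 0)) \<le> L * norm (?U n - ?U 0)"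
        using R by (intro Lip) (auto intro: less_imp_le)
      also have "\<dots> \<le> L * (2 * R)"
        using L R[of n] R[of 0] norm_triangle_ineq4[of "?U n" "?U 0"]
        by (intro mult_left_mono) auto
      finally show ?thesis
        using norm_triangle_sub[of "E' (?U n)" "E' (?U 0)"] by linarith
    qed
    then show "bounded (range (\<lambda>n. E' (?U n)))"
      unfolding bounded_iff by blast
  qed
  then show ?thesis unfolding U .
qed

end

section \<open>The local-minimum greedy algorithm\<close>

theorem theorem5p1:
  fixes \<T> :: "(real ^ 'p) set" and \<X> :: "(real ^ 'd) set"
    and m :: identification
    and \<phi>\<^sub>t :: "'vt::{real_inner,complete_space} \<Rightarrow> real ^ 'p \<Rightarrow> real"
    and \<phi>\<^sub>x :: "'vx::{real_inner,complete_space} \<Rightarrow> real ^ 'd \<Rightarrow> real"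
    and \<phi> :: "'v::{real_inner,complete_space} \<Rightarrow> (real ^ 'p) \<times> (real ^ 'd) \<Rightarrow> real"
    and tens :: "'vt \<Rightarrow> 'vx \<Rightarrow> 'v"
    and \<E> :: "'v \<Rightarrow> real" and \<E>' :: "'v \<Rightarrow> 'v"
  assumes "open \<T>" and "open \<X>"
    and Vt: "function_space_on m \<T> \<phi>\<^sub>t"
    and Vx: "function_space_on m \<X> \<phi>\<^sub>x"
    and V: "function_space_on m (\<T> \<times> \<X>) \<phi>"
    and tens: "\<And>r s. agree_on m (\<T> \<times> \<X>) (\<phi> (tens r s)) (\<lambda>(t, x). \<phi>\<^sub>t r t * \<phi>\<^sub>x s x)"
    and gradient: "\<And>v. GDERIV \<E> v :> \<E>' v"
    and A1: "closure (span (simple_tensors tens)) = UNIV"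
    and A2: "\<And>v::nat \<Rightarrow> 'v. range v \<subseteq> simple_tensors tens \<Longrightarrow> bounded (range v) \<Longrightarrow>
              \<exists>l\<in>simple_tensors tens. \<exists>\<sigma>::nat \<Rightarrow> nat. strict_mono \<sigma> \<and> weakly_converges_to (v \<circ> \<sigma>) l"
    and A3: "\<exists>\<alpha>>0. \<forall>v w. \<E> v \<ge> \<E> w + inner (\<E>' w) (v - w) + \<alpha> / 2 * (norm (v - w))\<^sup>2"
    and A4: "\<And>K. bounded K \<Longrightarrow> \<exists>L\<ge>0. \<forall>v\<in>K. \<forall>w\<in>K. norm (\<E>' v - \<E>' w) \<le> L * norm (v - w)"
    and A5: "\<exists>\<beta>>0. \<exists>\<gamma>\<ge>0. \<forall>r s. \<beta> * norm r * norm s \<le> norm (tens r s) \<and>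
                                norm (tens r s) \<le> \<gamma> * norm r * norm s"
  shows "(\<exists>!u. global_minimizer \<E> u) \<and>
         (\<forall>r s n. n \<ge> 1 \<longrightarrow> (\<forall>k\<in>{1..<n}. greedy_iteration \<E> tens r s k) \<longrightarrow>
           \<not> global_minimizer \<E> (greedy_sum tens r s (n - 1)) \<longrightarrow>
           (\<exists>r\<^sub>n s\<^sub>n. greedy_step \<E> tens (greedy_sum tens r s (n - 1)) r\<^sub>n s\<^sub>n)) \<and>
         (\<forall>r s u. (\<forall>n\<ge>1. greedy_iteration \<E> tens r s n) \<longrightarrow> global_minimizer \<E> u \<longrightarrow>
           greedy_sum tens r s \<longlonglongrightarrow> u)"
proof -
  obtain \<alpha> where \<alpha>: "\<alpha> > 0"
    "\<And>v w. \<E> w + inner (\<E>' w) (v - w) + \<alpha> / 2 * (norm (v - w))\<^sup>2 \<le> \<E> v"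
    using A3 by blast
  obtain \<beta> \<gamma> where \<beta>: "\<beta> > 0" "\<And>r s. \<beta> * norm r * norm s \<le> norm (tens r s)"
    and \<gamma>: "\<And>r s. norm (tens r s) \<le> \<gamma> * norm r * norm s"
    using A5 by blast
  interpret strongly_convex_functional \<E> \<E>' \<alpha>
    by unfold_locales (fact gradient \<alpha>)+
  interpret bounded_bilinear tens
    by (rule bounded_bilinear_tensor[OF Vt Vx V tens \<gamma>])
  interpret tensor_greedy \<E> \<E>' \<alpha> tens
    by unfold_locales (fact A1)
  show ?thesis
  proof (intro conjI allI impI)
    show "\<exists>!u. global_minimizer \<E> u"
      by (rule ex1_global_minimizer)
  next
    fix r s n
    assume "\<not> global_minimizer \<E> (greedy_sum tens r s (n - 1))"
    then show "\<exists>r\<^sub>n s\<^sub>n. greedy_step \<E> tens (greedy_sum tens r s (n - 1)) r\<^sub>n s\<^sub>n"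
      by (rule ex_greedy_step[rotated]) (rule A2)
  next
    fix r s u
    assume "\<forall>n\<ge>1. greedy_iteration \<E> tens r s n" and "global_minimizer \<E> u"
    then show "greedy_sum tens r s \<longlonglongrightarrow> u"
      by (intro greedy_iterates_converge[OF A4 \<beta> \<gamma>]) auto
  qed
qed

end
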